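(* Let $\mathbb{T}$ be the homogeneous tree of degree $q+1>2$, let $f,g:\mathbb{T}\to\mathbb{C}$, and let $u:\mathbb{T}\times\mathbb{Z}\to\mathbb{C}$ be the solution to the shifted wave equation $$\gamma\,\mathcal{L}^{\mathbb{Z}}_n u(x,n)=\bigl(\mathcal{L}^{\mathbb{T}}_x-1+\gamma\bigr)u(x,n),\qquad u(x,0)=f(x),\quad \tfrac{u(x,1)-u(x,-1)}2=g(x).$$ Then, for all $x\in\mathbb{T}$ and all $n\in\mathbb{Z}\setminus\{0\}$, $$u(x,n)=\tfrac12\,q^{-\frac{|n|}2}\sum_{d(y,x)=|n|}f(y)-\tfrac{q-1}2\,q^{-\frac{|n|}2}\sum_{\substack{d(y,x)<|n|\\ |n|-d(y,x)\text{ even}}}f(y)+\operatorname{sign}(n)\,q^{-\frac{|n|-1}2}\sum_{\substack{d(y,x)<|n|\\ |n|-d(y,x)\text{ odd}}}g(y).$$ In other words, $u(x,n)=C_nf(x)+S_ng(x)$ with $$C_n=\tfrac{M_{|n|}-M_{|n|-2}}2,\qquad S_n=\operatorname{sign}(n)\,M_{|n|-1},$$ where $$M_nf(x)=q^{-\frac n2}\sum_{\substack{d(y,x)\le n\\ n-d(y,x)\text{ even}}}f(y)\quad\text{if }n\ge0,\qquad M_{-1}=0.$$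
   Context: $\mathbb{T}=\mathbb{T}_q$ ($q\ge2$ an integer) is the homogeneous tree of degree $q+1$: the connected graph without loops in which every vertex has exactly $q+1$ neighbors. It is identified with its vertex set; $d$ is the graph distance and $S(x,n)=\{y\in\mathbb{T}: d(x,y)=n\}$. The combinatorial Laplacians are $$\mathcal{L}^{\mathbb{Z}}f(n)=f(n)-\tfrac{f(n+1)+f(n-1)}2\quad(n\in\mathbb{Z}),\qquad \mathcal{L}^{\mathbb{T}}f(x)=f(x)-\tfrac1{q+1}\sum_{y\in S(x,1)}f(y)\quad(x\in\mathbb{T}),$$ and a subscript ($\mathcal{L}^{\mathbb{Z}}_n$, $\mathcal{L}^{\mathbb{T}}_x$) indicates the variable in which the operator acts. Moreover $\gamma=\frac2{q^{1/2}+q^{-1/2}}\in(0,1)$. *)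

theory Defs
  imports Complex_Main "Graph_Theory.Digraph_Component"
begin

text \<open>
  A simple undirected graph is represented by a symmetric loop-free relation of arcs.
  In such a digraph the library's notion of cycle also covers the back-and-forth walk
  \<open>a, b, a\<close> of length 2 (so its \<open>forest\<close> and \<open>tree\<close> are not the undirected notions);
  the cycles of the undirected graph are those of length at least 3.
  The positive cardinality in the degree condition makes the graph locally finite.
\<close>

locale homogeneous_tree = pair_bidirected_digraph T
  for T :: "'a pair_pre_digraph" +
  fixes q :: nat
  assumes q_ge_2: "q \<ge> 2"
    and connected: "connected T"
    and acyclic: "\<not> (\<exists>p. cycle p \<and> length p \<ge> 3)"
    and degree: "\<And>x. x \<in> pverts T \<Longrightarrow> out_degree T x = q + 1"

text \<open>Meaningful only if \<open>y\<close> is reachable from \<open>x\<close>.\<close>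

definition graph_dist :: "'a pair_pre_digraph \<Rightarrow> 'a \<Rightarrow> 'a \<Rightarrow> nat" where
  "graph_dist T x y = (LEAST n. \<exists>p. pre_digraph.awalk T x p y \<and> length p = n)"

definition graph_sphere :: "'a pair_pre_digraph \<Rightarrow> 'a \<Rightarrow> nat \<Rightarrow> 'a set" where
  "graph_sphere T x n = {y \<in> pverts T. graph_dist T x y = n}"

definition laplacian_Z :: "(int \<Rightarrow> complex) \<Rightarrow> int \<Rightarrow> complex" where
  "laplacian_Z f n = f n - (f (n + 1) + f (n - 1)) / 2"

definition laplacian_T ::
  "'a pair_pre_digraph \<Rightarrow> nat \<Rightarrow> ('a \<Rightarrow> complex) \<Rightarrow> 'a \<Rightarrow> complex" where
  "laplacian_T T q f x = f x - 1 / of_nat (q + 1) * (\<Sum>y\<in>graph_sphere T x 1. f y)"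

definition tree_gamma :: "nat \<Rightarrow> real" where
  "tree_gamma q = 2 / (real q powr (1/2) + real q powr (- 1/2))"

text \<open>
  The index is an integer so that \<open>M\<^sub>-\<^sub>1 = 0\<close> can be expressed; indices below \<open>-1\<close> are
  not used for \<open>n \<noteq> 0\<close> in the operators \<open>C\<^sub>n\<close> and \<open>S\<^sub>n\<close> below.
\<close>

definition wave_M ::
  "'a pair_pre_digraph \<Rightarrow> nat \<Rightarrow> int \<Rightarrow> ('a \<Rightarrow> complex) \<Rightarrow> 'a \<Rightarrow> complex" where
  "wave_M T q n f x =
    (if n \<ge> 0
     then of_real (real q powr (- real_of_int n / 2)) *
       (\<Sum>y\<in>{y \<in> pverts T. int (graph_dist T y x) \<le> n \<and> even (n - int (graph_dist T y x))}. f y)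
     else 0)"

definition wave_C ::
  "'a pair_pre_digraph \<Rightarrow> nat \<Rightarrow> int \<Rightarrow> ('a \<Rightarrow> complex) \<Rightarrow> 'a \<Rightarrow> complex" where
  "wave_C T q n f x = (wave_M T q \<bar>n\<bar> f x - wave_M T q (\<bar>n\<bar> - 2) f x) / 2"

definition wave_S ::
  "'a pair_pre_digraph \<Rightarrow> nat \<Rightarrow> int \<Rightarrow> ('a \<Rightarrow> complex) \<Rightarrow> 'a \<Rightarrow> complex" where
  "wave_S T q n g x = of_int (sgn n) * wave_M T q (\<bar>n\<bar> - 1) g x"

end

theory Submission
  imports Defs
begin

text \<open>
  Write \<open>A h\<close> for the function whose value at \<open>x\<close> is the sum of \<open>h\<close> over the neighbours of \<open>x\<close>.
  The factor \<open>\<gamma>\<close> equals \<open>2 q\<^bsup>1/2\<^esup> / (q + 1)\<close>, so the shifted wave equation is the two-term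
  recurrence \<open>u\<^bsub>n+1\<^esub> + u\<^bsub>n-1\<^esub> = q\<^bsup>-1/2\<^esup> A u\<^sub>n\<close> (\<open>wave_step\<close>), which together with the
  values at times \<open>0\<close> and \<open>1\<close> determines \<open>u\<close> at all positive times.

  The operators \<open>M\<^sub>n\<close> satisfy the same recurrence for \<open>n \<ge> 0\<close> (\<open>wave_M_rec\<close>). After clearing the
  powers of \<open>q\<close>, this says that summing, over the neighbours \<open>z\<close> of \<open>x\<close>, the sums over the balls
  of radius \<open>n\<close> and fixed parity around \<open>z\<close> counts every \<open>y\<close> at distance \<open>n + 1\<close> from \<open>x\<close> once
  and every \<open>y\<close> at a distance at most \<open>n - 1\<close> of the same parity \<open>q + 1\<close> times
  (\<open>card_nbrs_in_parity_ball\<close>). The geometric input is that exactly one neighbour of \<open>x\<close> is at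
  distance \<open>d(x, y) - 1\<close> from a vertex \<open>y \<noteq> x\<close> and all others are at distance \<open>d(x, y) + 1\<close>
  (\<open>graph_dist_nbrs\<close>). This in turn holds because, in the absence of cycles, any two vertices are
  joined by only one walk without backtracking (\<open>reduced_awalk_unique\<close>).

  Hence \<open>C\<^sub>n f + S\<^sub>n g\<close>, with the value \<open>f\<close> at \<open>n = 0\<close>, obeys the same recurrence as \<open>u\<close> and has
  the same values at times \<open>0\<close> and \<open>1\<close>, so the two agree for \<open>n > 0\<close> (\<open>wave_solution\<close>). Negative times follow by applying this to the time-reversed
  solution, for which \<open>g\<close> changes sign. Separating the sphere from the interior of the ball gives
  the explicit formula (\<open>wave_C_explicit\<close>, \<open>wave_S_explicit\<close>).
\<close>

section \<open>Walks without backtracking\<close>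

text \<open>A list of arcs in which no arc is immediately followed by one leading back to where the first
  one started. That consecutive arcs fit together is not part of the definition.\<close>

definition reduced :: "('a \<times> 'a) list \<Rightarrow> bool" where
  "reduced p \<longleftrightarrow> successively (\<lambda>e e'. snd e' \<noteq> fst e) p"

lemma reduced_Nil [simp]: "reduced []"
  by (simp add: reduced_def)

lemma reduced_Cons:
  "reduced (e # p) \<longleftrightarrow> reduced p \<and> (p \<noteq> [] \<longrightarrow> snd (hd p) \<noteq> fst e)"
  by (cases p) (auto simp: reduced_def)

lemma reduced_append:
  "reduced (p @ q) \<longleftrightarrow>
     reduced p \<and> reduced q \<and> (p \<noteq> [] \<longrightarrow> q \<noteq> [] \<longrightarrow> snd (hd q) \<noteq> fst (last p))"
  by (auto simp: reduced_def successively_append_iff)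

lemma last_rev_path: "p \<noteq> [] \<Longrightarrow> last (rev_path p) = (snd (hd p), fst (hd p))"
  by (cases p) auto

lemma reduced_rev_path: "reduced p \<Longrightarrow> reduced (rev_path p)"
  by (induct p) (auto simp: reduced_Cons reduced_append last_rev_path)

context homogeneous_tree
begin

text \<open>By induction, the walk after its first arc is a path. If it returned to the starting vertex, the
  closed part would be a cycle, of length at least 3 because there are neither loops nor
  backtracking.\<close>

lemma reduced_awalk_imp_apath:
  assumes "awalk u p v" "reduced p"
  shows "apath u p v"
  using assms
proof (induct p arbitrary: u)
  case Nil
  then show ?case by (auto simp: apath_Nil_iff awalk_Nil_iff)
next
  case (Cons e p)
  then have e: "e \<in> parcs T" "fst e = u" and p: "awalk (snd e) p v" "apath (snd e) p v"
    by (auto simp: awalk_Cons_iff reduced_Cons)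
  have "u \<notin> set (pawalk_verts (snd e) p)"
  proof
    assume "u \<in> set (pawalk_verts (snd e) p)"
    then obtain p1 p2 where split: "p = p1 @ p2" and p1: "awalk (snd e) p1 u"
      using awalk_decomp[OF p(1)] by blast
    have "distinct (pawalk_verts (snd e) p1)"
      using p split by (auto simp: apath_def awalk_verts_append)
    then have "cycle (e # p1)"
      using e p1 by (auto simp: cycle_def awalk_Cons_iff)
    then have "length p1 \<le> 1"
      using acyclic by (force simp: not_le)
    moreover have "p1 \<noteq> []"
      using p1 e(2) pair_no_loops[OF e(1)] by (auto simp: awalk_Nil_iff)
    ultimately obtain e' where "p1 = [e']"
      by (cases p1) auto
    then show False
      using p1 split Cons.prems(2) e by (auto simp: awalk_simps reduced_Cons)
  qed
  then show ?case
    using e p by (auto simp: apath_Cons_iff)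
qed

lemma reduced_awalk_unique:
  assumes "awalk u p v" "reduced p" "awalk u p' v" "reduced p'"
  shows "p = p'"
  using assms
proof (induct p arbitrary: u p')
  case Nil
  then have "apath u p' u"
    using reduced_awalk_imp_apath by (auto simp: awalk_Nil_iff)
  then show ?case
    using apath_nonempty_ends by blast
next
  case (Cons e p)
  have "p' \<noteq> []"
    using Cons.prems reduced_awalk_imp_apath[of u "e # p" v] apath_nonempty_ends
    by (auto simp: awalk_Nil_iff)
  then obtain e' r where p': "p' = e' # r"
    by (cases p') auto
  have "e = e'"
  proof (rule ccontr)
    assume "e \<noteq> e'"
    then have "snd e \<noteq> snd e'"
      using Cons.prems p' by (auto simp: awalk_Cons_iff prod_eq_iff)
    \<comment> \<open>Going back along one walk and out along the other closes up without backtracking.\<close>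
    then have "reduced (rev_path (e # p) @ p')"
      unfolding reduced_append using Cons.prems p' reduced_rev_path[of "e # p"]
      by auto
    moreover have "awalk v (rev_path (e # p) @ p') v"
      using Cons.prems awalk_appendI awalk_rev_path by metis
    ultimately show False
      using reduced_awalk_imp_apath apath_nonempty_ends[of v "rev_path (e # p) @ p'" v] p' by blast
  qed
  then show ?case
    using Cons p' by (auto simp: awalk_Cons_iff reduced_Cons)
qed

section \<open>Distances in the tree\<close>

lemma graph_dist_le: "awalk x p y \<Longrightarrow> graph_dist T x y \<le> length p"
  unfolding graph_dist_def by (rule Least_le) auto

lemma geodesic_exists:
  assumes "x \<in> pverts T" "y \<in> pverts T"
  obtains p where "awalk x p y" "length p = graph_dist T x y"
proof -
  have "x \<rightarrow>\<^sup>*\<^bsub>mk_symmetric T\<^esub> y"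
    using connected assms by (auto simp: connected_def strongly_connected_def)
  then have "\<exists>n p. awalk x p y \<and> length p = n"
    using reachable_mk_symmetric_eq[OF pair_sym_arcs] reachable_awalk by auto
  then have "\<exists>p. awalk x p y \<and> length p = graph_dist T x y"
    unfolding graph_dist_def by (rule LeastI_ex)
  then show thesis using that by blast
qed

lemma geodesic_reduced:
  assumes "awalk x p y" "length p = graph_dist T x y"
  shows "reduced p"
  using assms
proof (induct p arbitrary: x)
  case Nil
  then show ?case by simp
next
  case (Cons e p)
  then have e: "e \<in> parcs T" "fst e = x" and p: "awalk (snd e) p y"
    by (auto simp: awalk_Cons_iff)
  obtain p' where p': "awalk (snd e) p' y" "length p' = graph_dist T (snd e) y"
    using geodesic_exists p awalk_hd_in_verts awalk_last_in_verts by metis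
  have "awalk x (e # p') y"
    using e p' by (simp add: awalk_Cons_iff)
  then have "length p = graph_dist T (snd e) y"
    using graph_dist_le[of x "e # p'" y] graph_dist_le[OF p] Cons.prems(2) p' by simp
  then have "reduced p"
    using Cons.hyps p by blast
  moreover have "snd (hd p) \<noteq> fst e" if "p \<noteq> []"
  proof
    assume turn: "snd (hd p) = fst e"
    obtain e' r where r: "p = e' # r"
      using \<open>p \<noteq> []\<close> by (cases p) auto
    then have "awalk x r y"
      using p e turn by (auto simp: awalk_Cons_iff)
    then show False
      using graph_dist_le[of x r y] Cons.prems(2) r by simp
  qed
  ultimately show ?case
    by (simp add: reduced_Cons)
qed

lemma length_reduced_awalk:
  assumes "awalk x p y" "reduced p"
  shows "length p = graph_dist T x y"
  using assms geodesic_exists geodesic_reduced reduced_awalk_unique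
    awalk_hd_in_verts awalk_last_in_verts by metis

lemma graph_dist_sym:
  assumes "x \<in> pverts T" "y \<in> pverts T"
  shows "graph_dist T x y = graph_dist T y x"
proof -
  obtain p where p: "awalk x p y" "length p = graph_dist T x y"
    using geodesic_exists assms by blast
  have "length (rev_path p) = length p"
    by (induct p) auto
  moreover have "awalk y (rev_path p) x" "reduced (rev_path p)"
    using p geodesic_reduced reduced_rev_path by auto
  ultimately show ?thesis
    using length_reduced_awalk p(2) by metis
qed

lemma graph_dist_eq_0_iff:
  assumes "x \<in> pverts T" "y \<in> pverts T"
  shows "graph_dist T x y = 0 \<longleftrightarrow> x = y"
  using assms geodesic_exists[OF assms] graph_dist_le[of x "[]" y]
  by (metis awalk_Nil_iff le_zero_eq length_0_conv list.size(3) with_proj_simps(1))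

text \<open>The neighbours of a vertex, which also form its sphere of radius 1.\<close>

abbreviation nbrs :: "'a \<Rightarrow> 'a set" where
  "nbrs x \<equiv> {z. (x, z) \<in> parcs T}"

lemma graph_sphere_1:
  assumes "x \<in> pverts T"
  shows "graph_sphere T x 1 = nbrs x"
proof (intro set_eqI iffI)
  fix z assume "z \<in> graph_sphere T x 1"
  then obtain p where "awalk x p z" "length p = 1"
    using geodesic_exists[OF assms, of z] by (auto simp: graph_sphere_def)
  then show "z \<in> nbrs x"
    by (cases p) (auto simp: awalk_simps)
next
  fix z assume "z \<in> nbrs x"
  then have "awalk x [(x, z)] z" "reduced [(x, z)]" "z \<in> pverts T"
    by (auto simp: awalk_simps reduced_Cons dest: in_arcsD2)
  then show "z \<in> graph_sphere T x 1"
    using length_reduced_awalk[of x "[(x, z)]" z] by (simp add: graph_sphere_def)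
qed

lemma card_nbrs:
  assumes "x \<in> pverts T"
  shows "card (nbrs x) = q + 1"
proof -
  have "out_arcs T x = Pair x ` nbrs x"
    by (auto simp: out_arcs_def)
  then have "card (out_arcs T x) = card (nbrs x)"
    by (simp add: card_image inj_on_def)
  then show ?thesis
    using degree[OF assms] by (simp add: out_degree_def)
qed

lemma finite_nbrs: "x \<in> pverts T \<Longrightarrow> finite (nbrs x)"
  using card_nbrs[of x] by (metis Suc_eq_plus1 card.infinite nat.distinct(1))

lemma graph_dist_nbr_self:
  assumes "x \<in> pverts T" "z \<in> nbrs x"
  shows "graph_dist T x z = 1" "graph_dist T z x = 1"
proof -
  have "z \<in> graph_sphere T x 1"
    using assms graph_sphere_1 by simp
  then show "graph_dist T x z = 1" "graph_dist T z x = 1"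
    using graph_dist_sym[OF assms(1), of z] by (auto simp: graph_sphere_def)
qed

text \<open>Exactly one neighbour of \<open>x\<close> lies closer to \<open>y\<close>: it is the first step of the reduced walk
  to \<open>y\<close>, and prepending the arc from any other neighbour to this walk keeps it reduced.\<close>

lemma graph_dist_nbrs:
  assumes x: "x \<in> pverts T" and y: "y \<in> pverts T" and "x \<noteq> y"
  obtains w where "w \<in> nbrs x" "graph_dist T x y = graph_dist T w y + 1"
    "\<And>z. z \<in> nbrs x \<Longrightarrow> z \<noteq> w \<Longrightarrow> graph_dist T z y = graph_dist T x y + 1"
proof -
  obtain p where p: "awalk x p y" "length p = graph_dist T x y"
    using geodesic_exists x y by blast
  note red = geodesic_reduced[OF p]
  from p \<open>x \<noteq> y\<close> obtain w r where r: "p = (x, w) # r"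
    by (cases p) (auto simp: awalk_simps)
  show thesis
  proof (rule that[of w])
    show "w \<in> nbrs x"
      using p r by (simp add: awalk_Cons_iff)
    have "length r = graph_dist T w y"
      using p r red by (intro length_reduced_awalk) (auto simp: awalk_Cons_iff reduced_Cons)
    then show "graph_dist T x y = graph_dist T w y + 1"
      using p(2) r by simp
  next
    fix z assume z: "z \<in> nbrs x" "z \<noteq> w"
    then have "awalk z ((z, x) # p) y" "reduced ((z, x) # p)"
      using p r red arcs_symmetric by (auto simp: awalk_Cons_iff reduced_Cons)
    then show "graph_dist T z y = graph_dist T x y + 1"
      using length_reduced_awalk[of z "(z, x) # p" y] p(2) by simp
  qed
qed

section \<open>Sums over balls of fixed parity\<close>

text \<open>The vertices whose distance from \<open>x\<close> is at most \<open>n\<close> and has the parity of \<open>n\<close>. The radius is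
  an integer, so that \<open>n - 1\<close> and \<open>n - 2\<close> need no case distinction: the set is empty for
  negative \<open>n\<close>.\<close>

definition parity_ball :: "'a \<Rightarrow> int \<Rightarrow> 'a set" where
  "parity_ball x n = {y \<in> pverts T. int (graph_dist T y x) \<le> n \<and> even (n - int (graph_dist T y x))}"

lemma parity_ball_neg: "n < 0 \<Longrightarrow> parity_ball x n = {}"
  by (auto simp: parity_ball_def)

lemma parity_ball_0:
  assumes "x \<in> pverts T"
  shows "parity_ball x 0 = {x}"
proof -
  have "parity_ball x 0 = {y \<in> pverts T. graph_dist T y x = 0}"
    by (auto simp: parity_ball_def)
  also have "\<dots> = {x}"
    using assms graph_dist_eq_0_iff by auto
  finally show ?thesis .
qed

lemma finite_ball:
  "x \<in> pverts T \<Longrightarrow> finite {y \<in> pverts T. graph_dist T x y \<le> n}"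
proof (induct n arbitrary: x)
  case 0
  then have "{y \<in> pverts T. graph_dist T x y \<le> 0} \<subseteq> {x}"
    using graph_dist_eq_0_iff by auto
  then show ?case
    using finite_subset by blast
next
  case (Suc n)
  let ?B = "\<lambda>z. {y \<in> pverts T. graph_dist T z y \<le> n}"
  have "{y \<in> pverts T. graph_dist T x y \<le> Suc n} \<subseteq> insert x (\<Union>z\<in>nbrs x. ?B z)"
  proof
    fix y assume y: "y \<in> {y \<in> pverts T. graph_dist T x y \<le> Suc n}"
    show "y \<in> insert x (\<Union>z\<in>nbrs x. ?B z)"
    proof (cases "x = y")
      case False
      then obtain w where "w \<in> nbrs x" "graph_dist T x y = graph_dist T w y + 1"
        using graph_dist_nbrs[OF Suc.prems, of y] y by blast
      then show ?thesis
        using y by auto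
    qed simp
  qed
  moreover have "finite (insert x (\<Union>z\<in>nbrs x. ?B z))"
    using Suc finite_nbrs in_arcsD2 by auto
  ultimately show ?case
    using finite_subset by blast
qed

lemma finite_parity_ball:
  assumes "x \<in> pverts T"
  shows "finite (parity_ball x n)"
  by (rule finite_subset[OF _ finite_ball[OF assms, of "nat n"]])
     (auto simp: parity_ball_def graph_dist_sym[OF assms])

text \<open>For \<open>y \<noteq> x\<close>, the neighbour of \<open>x\<close> closer to \<open>y\<close> accounts for the first summand and the \<open>q\<close>
  remaining neighbours for the second one. For \<open>y = x\<close> there is no closer neighbour, but all
  \<open>q + 1\<close> neighbours are at distance 1, and both sides are \<open>q + 1\<close> or \<open>0\<close> according to the
  parity of \<open>n\<close>.\<close>

lemma card_nbrs_in_parity_ball: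
  assumes x: "x \<in> pverts T" and y: "y \<in> pverts T" and n: "n \<ge> 0"
  shows "card {z \<in> nbrs x. y \<in> parity_ball z n} =
    of_bool (y \<in> parity_ball x (n + 1)) + q * of_bool (y \<in> parity_ball x (n - 1))"
proof -
  have sym: "graph_dist T y z = graph_dist T z y" if "z \<in> pverts T" for z
    using graph_dist_sym y that by blast
  have nv: "z \<in> pverts T" if "z \<in> nbrs x" for z
    using that in_arcsD2 by auto
  have mem: "y \<in> parity_ball z m \<longleftrightarrow>
      int (graph_dist T z y) \<le> m \<and> even (m - int (graph_dist T z y))" if "z \<in> pverts T" for z m
    using y sym[OF that] by (simp add: parity_ball_def)
  define d where "d = int (graph_dist T x y)"
  consider "x = y" | "x \<noteq> y" by blast
  then show ?thesis
  proof cases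
    case 1
    then have "d = 0"
      using graph_dist_eq_0_iff x by (simp add: d_def)
    have "{z \<in> nbrs x. y \<in> parity_ball z n} = (if odd n then nbrs x else {})"
      using 1 n graph_dist_nbr_self[OF x] nv mem by (auto elim: oddE)
    then show ?thesis
      using card_nbrs[OF x] mem[OF x] \<open>d = 0\<close> n by (auto simp: d_def elim: oddE)
  next
    case 2
    obtain w where w: "w \<in> nbrs x" "graph_dist T x y = graph_dist T w y + 1"
      "\<And>z. z \<in> nbrs x \<Longrightarrow> z \<noteq> w \<Longrightarrow> graph_dist T z y = graph_dist T x y + 1"
      using graph_dist_nbrs[OF x y 2] by blast
    have in_w: "y \<in> parity_ball w n \<longleftrightarrow> d \<le> n + 1 \<and> even (n + 1 - d)"
      using mem[OF nv[OF w(1)]] w(2) by (auto simp: d_def)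
    have in_z: "y \<in> parity_ball z n \<longleftrightarrow> d \<le> n - 1 \<and> even (n + 1 - d)"
      if "z \<in> nbrs x" "z \<noteq> w" for z
      unfolding mem[OF nv[OF that(1)]] w(3)[OF that] d_def by auto
    have in_x: "y \<in> parity_ball x (n + 1) \<longleftrightarrow> d \<le> n + 1 \<and> even (n + 1 - d)"
       "y \<in> parity_ball x (n - 1) \<longleftrightarrow> d \<le> n - 1 \<and> even (n + 1 - d)"
      using mem[OF x] by (auto simp: d_def)
    have "{z \<in> nbrs x. y \<in> parity_ball z n} =
        {z \<in> nbrs x. (if z = w then d \<le> n + 1 else d \<le> n - 1) \<and> even (n + 1 - d)}"
      using in_w in_z by (intro Collect_cong conj_cong) (simp_all split: if_split)
    also have "\<dots> =
        (if d \<le> n - 1 \<and> even (n + 1 - d) then nbrs x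
         else if d \<le> n + 1 \<and> even (n + 1 - d) then {w} else {})"
      using w(1) by (cases "even (n + 1 - d)"; cases "d \<le> n - 1"; cases "d \<le> n + 1")
        (simp_all, auto)
    finally have nbrs_eq: "{z \<in> nbrs x. y \<in> parity_ball z n} =
        (if d \<le> n - 1 \<and> even (n + 1 - d) then nbrs x
         else if d \<le> n + 1 \<and> even (n + 1 - d) then {w} else {})" .
    show ?thesis
      unfolding nbrs_eq in_x using card_nbrs[OF x]
      by (cases "even (n + 1 - d)"; cases "d \<le> n - 1"; cases "d \<le> n + 1") simp_all
  qed
qed

lemma sum_nbrs_parity_ball:
  fixes h :: "'a \<Rightarrow> complex"
  assumes x: "x \<in> pverts T" and n: "n \<ge> 0"
  shows "(\<Sum>z\<in>nbrs x. \<Sum>y\<in>parity_ball z n. h y) =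
    (\<Sum>y\<in>parity_ball x (n + 1). h y) + of_nat q * (\<Sum>y\<in>parity_ball x (n - 1). h y)"
proof -
  have nv: "z \<in> pverts T" if "z \<in> nbrs x" for z
    using that in_arcsD2 by auto
  \<comment> \<open>A finite set containing all balls involved, so that the two sums can be interchanged.\<close>
  define D where "D = (\<Union>z\<in>nbrs x. parity_ball z n) \<union> parity_ball x (n + 1) \<union> parity_ball x (n - 1)"
  have D: "finite D" "D \<subseteq> pverts T"
    using finite_nbrs[OF x] finite_parity_ball x nv unfolding D_def
    by (blast, auto simp: parity_ball_def)
  have restrict: "(\<Sum>y\<in>A. h y) = (\<Sum>y\<in>D. of_bool (y \<in> A) * h y)" if "A \<subseteq> D" for A
    using D(1) that by (intro sum.mono_neutral_cong_left) auto
  have "(\<Sum>z\<in>nbrs x. \<Sum>y\<in>parity_ball z n. h y) =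
      (\<Sum>z\<in>nbrs x. \<Sum>y\<in>D. of_bool (y \<in> parity_ball z n) * h y)"
    by (intro sum.cong restrict) (auto simp: D_def)
  also have "\<dots> = (\<Sum>y\<in>D. of_nat (card {z \<in> nbrs x. y \<in> parity_ball z n}) * h y)"
    by (subst sum.swap) (simp add: finite_nbrs[OF x] sum_distrib_right[symmetric] Int_def)
  also have "\<dots> = (\<Sum>y\<in>D. of_bool (y \<in> parity_ball x (n + 1)) * h y +
      of_nat q * (of_bool (y \<in> parity_ball x (n - 1)) * h y))"
    using D(2) card_nbrs_in_parity_ball[OF x _ n]
    by (intro sum.cong) (auto simp: algebra_simps)
  also have "\<dots> = (\<Sum>y\<in>parity_ball x (n + 1). h y) + of_nat q * (\<Sum>y\<in>parity_ball x (n - 1). h y)"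
    by (subst (1 2) restrict) (auto simp: D_def sum.distrib sum_distrib_left)
  finally show ?thesis .
qed

text \<open>In this form the convention that \<open>M\<^sub>n = 0\<close> for \<open>n < 0\<close> is an empty sum.\<close>

lemma wave_M_eq:
  "wave_M T q n h x = of_real (real q powr (- real_of_int n / 2)) * (\<Sum>y\<in>parity_ball x n. h y)"
  by (cases "n < 0") (simp_all add: wave_M_def parity_ball_neg, simp add: parity_ball_def)

lemma wave_M_0: "x \<in> pverts T \<Longrightarrow> wave_M T q 0 h x = h x"
  using q_ge_2 by (simp add: wave_M_eq parity_ball_0)

lemma powr_half_shift:
  "real q powr (- real_of_int (n + 1) / 2) = real q powr (- 1 / 2) * real q powr (- real_of_int n / 2)"
  "real q powr (- real_of_int (n - 1) / 2) =
     real q * (real q powr (- 1 / 2) * real q powr (- real_of_int n / 2))"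
  "real q powr (- real_of_int (n - 2) / 2) = real q * real q powr (- real_of_int n / 2)"
proof -
  have "real q powr (1 + a) = real q * real q powr a" for a
    using q_ge_2 by (simp add: powr_add)
  from this[of "- 1 / 2 - real_of_int n / 2"] this[of "- real_of_int n / 2"]
  show "real q powr (- real_of_int (n + 1) / 2) =
      real q powr (- 1 / 2) * real q powr (- real_of_int n / 2)"
    "real q powr (- real_of_int (n - 1) / 2) =
      real q * (real q powr (- 1 / 2) * real q powr (- real_of_int n / 2))"
    "real q powr (- real_of_int (n - 2) / 2) = real q * real q powr (- real_of_int n / 2)"
    by (simp_all add: powr_add[symmetric] field_simps)
qed

lemma wave_M_rec:
  assumes "x \<in> pverts T" "n \<ge> 0"
  shows "wave_M T q (n + 1) h x + wave_M T q (n - 1) h x =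
    of_real (real q powr (- 1 / 2)) * (\<Sum>z\<in>nbrs x. wave_M T q n h z)"
  unfolding wave_M_eq powr_half_shift sum_distrib_left[symmetric] sum_nbrs_parity_ball[OF assms]
  by (simp add: algebra_simps)

section \<open>The shifted wave equation\<close>

text \<open>The terms without time shift cancel, and \<open>\<gamma> / 2 = q\<^bsup>1/2\<^esup> / (q + 1)\<close>.\<close>

lemma wave_step:
  assumes x: "x \<in> pverts T"
    and eq: "of_real (tree_gamma q) * laplacian_Z (\<lambda>m. u x m) n =
      laplacian_T T q (\<lambda>y. u y n) x - u x n + of_real (tree_gamma q) * u x n"
  shows "u x (n + 1) + u x (n - 1) = of_real (real q powr (- 1 / 2)) * (\<Sum>z\<in>nbrs x. u z n)"
proof -
  define s where "s = real q powr (1 / 2)"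
  have s: "s > 0" "s * s = real q"
    using q_ge_2 by (simp_all add: s_def powr_add[symmetric])
  have s': "real q powr (- 1 / 2) = 1 / s"
    using q_ge_2 by (simp add: s_def powr_minus_divide)
  have \<gamma>: "tree_gamma q * (real q + 1) = 2 * s"
  proof -
    have "tree_gamma q * (s * s + 1) = 2 * s"
      using s(1) add_pos_pos[of 1 "s * s"] unfolding tree_gamma_def s_def[symmetric] s'
      by (simp add: divide_simps algebra_simps)
    then show ?thesis
      by (simp only: s(2))
  qed
  let ?N = "\<Sum>z\<in>nbrs x. u z n"
  have "of_real (tree_gamma q) * (u x (n + 1) + u x (n - 1)) * (of_nat q + 1) = 2 * ?N"
  proof -
    have "of_real (tree_gamma q) * (u x (n + 1) + u x (n - 1)) = 2 * ?N / (of_nat q + 1)"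
      using eq[unfolded laplacian_Z_def laplacian_T_def graph_sphere_1[OF x]]
      by (simp add: algebra_simps)
    then show ?thesis
      using of_nat_neq_0[of q, where 'a = complex] by (simp add: divide_simps algebra_simps)
  qed
  moreover have "2 * of_real s = complex_of_real (tree_gamma q) * (of_nat q + 1)"
    using arg_cong[OF \<gamma>, of complex_of_real] by simp
  then have "2 * of_real s * (u x (n + 1) + u x (n - 1)) =
      of_real (tree_gamma q) * (u x (n + 1) + u x (n - 1)) * (of_nat q + 1)"
    by (simp only: mult_ac)
  ultimately have "2 * of_real s * (u x (n + 1) + u x (n - 1)) = 2 * ?N"
    by simp
  then have "of_real s * (u x (n + 1) + u x (n - 1)) = ?N"
    by simp
  then show ?thesis
    unfolding s' using s(1) by (simp add: divide_simps mult.commute)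
qed

text \<open>The solution at positive times, stated over the natural numbers so that it applies to both time
  directions. The value of \<open>v\<close> at time 1 is the one forced by the recurrence and
  \<open>(v(x, 1) - v(x, -1)) / 2 = g(x)\<close>. The formula itself fails at time 0, where it would give
  \<open>f(x) / 2\<close> because \<open>M\<^bsub>-2\<^esub> = 0\<close>, so the step to time 2 is treated separately.\<close>

lemma wave_solution:
  fixes v :: "'a \<Rightarrow> nat \<Rightarrow> complex"
  assumes rec: "\<And>x n. x \<in> pverts T \<Longrightarrow>
      v x (n + 2) + v x n = of_real (real q powr (- 1 / 2)) * (\<Sum>z\<in>nbrs x. v z (n + 1))"
    and v0: "\<And>x. x \<in> pverts T \<Longrightarrow> v x 0 = f x"
    and v1: "\<And>x. x \<in> pverts T \<Longrightarrow>
      v x 1 = of_real (real q powr (- 1 / 2)) * (\<Sum>z\<in>nbrs x. f z) / 2 + g x"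
    and x: "x \<in> pverts T"
  shows "v x (n + 1) =
    (wave_M T q (int n + 1) f x - wave_M T q (int n - 1) f x) / 2 + wave_M T q (int n) g x"
  using x
proof (induct n arbitrary: x rule: less_induct)
  case (less n)
  let ?c = "complex_of_real (real q powr (- 1 / 2))"
  let ?A = "\<lambda>h. ?c * (\<Sum>z\<in>nbrs x. h z)"
  let ?M = "wave_M T q"
  note x = less.prems
  have nv: "z \<in> pverts T" if "z \<in> nbrs x" for z
    using that in_arcsD2 by auto
  have M0: "?A (?M 0 h) = ?A h" for h
    using wave_M_0 nv by simp
  have M_rec: "?M (k + 1) h x = ?A (?M k h) - ?M (k - 1) h x" if "k \<ge> 0" for k h
    using wave_M_rec[OF x that, of h] by (simp add: eq_diff_eq)
  have M_neg: "?M k h z = 0" if "k < 0" for k h z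
    using that by (simp add: wave_M_def)
  show ?case
  proof (cases n)
    case 0
    have "v x 1 = ?A (?M 0 f) / 2 + g x"
      using v1[OF x] by (simp only: M0)
    then show ?thesis
      using 0 M_rec[of 0 f] wave_M_0[OF x, of g] by (simp add: M_neg)
  next
    case (Suc m)
    have "?A (\<lambda>z. v z (m + 1)) =
        ?A (\<lambda>z. (?M (int m + 1) f z - ?M (int m - 1) f z) / 2 + ?M (int m) g z)"
      using less.hyps[of m] Suc nv by simp
    also have "\<dots> = (?A (?M (int m + 1) f) - ?A (?M (int m - 1) f)) / 2 + ?A (?M (int m) g)"
      by (simp add: sum.distrib sum_subtractf sum_divide_distrib[symmetric] algebra_simps
          diff_divide_distrib)
    finally have step: "v x (m + 2) =
        (?A (?M (int m + 1) f) - ?A (?M (int m - 1) f)) / 2 + ?A (?M (int m) g) - v x m"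
      using rec[OF x, of m] by (simp add: eq_diff_eq)
    show ?thesis
    proof (cases m)
      case 0
      then show ?thesis
        using step v0[OF x] M_rec[of 1 f] M_rec[of 0 g] wave_M_0[OF x, of f] Suc
        by (simp add: M_neg diff_divide_distrib)
    next
      case (Suc l)
      have "v x m = (?M (int m) f x - ?M (int m - 2) f x) / 2 + ?M (int m - 1) g x"
        using less.hyps[of l, OF _ x] Suc \<open>n = Suc m\<close> by (simp add: add.commute)
      moreover have "int m \<ge> 1"
        using Suc by simp
      ultimately have "v x (m + 2) =
          (?M (int m + 2) f x - ?M (int m) f x) / 2 + ?M (int m + 1) g x"
        unfolding step
        using wave_M_rec[OF x, of "int m + 1" f, symmetric]
          wave_M_rec[OF x, of "int m - 1" f, symmetric] wave_M_rec[OF x, of "int m" g, symmetric]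
        by (simp add: diff_divide_distrib add_divide_distrib add.commute)
      then show ?thesis
        using \<open>n = Suc m\<close> by (simp add: add.commute)
    qed
  qed
qed

text \<open>For \<open>n > 0\<close>, a vertex at distance less than \<open>n\<close> of the same parity has weight \<open>q\<^bsup>-n/2\<^esup>\<close> in \<open>M\<^sub>n\<close> and
  \<open>q \<cdot> q\<^bsup>-n/2\<^esup>\<close> in \<open>M\<^bsub>n-2\<^esub>\<close>, which produces the coefficient \<open>q - 1\<close>.\<close>

lemma wave_C_explicit:
  assumes x: "x \<in> pverts T" and n: "n \<noteq> 0"
  shows "wave_C T q n f x =
      1 / 2 * of_real (real q powr (- real_of_int \<bar>n\<bar> / 2)) *
        (\<Sum>y\<in>{y \<in> pverts T. int (graph_dist T y x) = \<bar>n\<bar>}. f y)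
      - (of_nat q - 1) / 2 * of_real (real q powr (- real_of_int \<bar>n\<bar> / 2)) *
        (\<Sum>y\<in>{y \<in> pverts T. int (graph_dist T y x) < \<bar>n\<bar> \<and> even (\<bar>n\<bar> - int (graph_dist T y x))}. f y)"
proof -
  let ?S = "{y \<in> pverts T. int (graph_dist T y x) = \<bar>n\<bar>}"
  have "(int d < m \<and> even (m - int d)) = (int d \<le> m - 2 \<and> even (m - 2 - int d))" for d m
    by presburger
  note less_le = this
  have inner: "{y \<in> pverts T. int (graph_dist T y x) < \<bar>n\<bar> \<and> even (\<bar>n\<bar> - int (graph_dist T y x))} =
      parity_ball x (\<bar>n\<bar> - 2)"
    unfolding parity_ball_def less_le ..
  have split: "parity_ball x \<bar>n\<bar> = ?S \<union> parity_ball x (\<bar>n\<bar> - 2)"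
  proof -
    have "(int d \<le> m \<and> even (m - int d)) = (int d = m \<or> int d < m \<and> even (m - int d))" for d m
      by auto
    then show ?thesis
      unfolding inner[symmetric] unfolding parity_ball_def
      by (simp only: Collect_disj_eq[symmetric] conj_disj_distribL[symmetric])
  qed
  have "finite (parity_ball x \<bar>n\<bar>)"
    using finite_parity_ball x by blast
  then have "(\<Sum>y\<in>parity_ball x \<bar>n\<bar>. f y) = (\<Sum>y\<in>?S. f y) + (\<Sum>y\<in>parity_ball x (\<bar>n\<bar> - 2). f y)"
    unfolding split by (intro sum.union_disjoint) (auto simp: parity_ball_def)
  then show ?thesis
    unfolding wave_C_def wave_M_eq inner powr_half_shift(3) by (simp add: field_simps)
qed

lemma wave_S_explicit:
  "wave_S T q n g x =
      of_int (sgn n) * of_real (real q powr (- (real_of_int \<bar>n\<bar> - 1) / 2)) *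
        (\<Sum>y\<in>{y \<in> pverts T. int (graph_dist T y x) < \<bar>n\<bar> \<and> odd (\<bar>n\<bar> - int (graph_dist T y x))}. g y)"
proof -
  have "(int d < m \<and> odd (m - int d)) = (int d \<le> m - 1 \<and> even (m - 1 - int d))" for d m
    by presburger
  note less_le = this
  have "{y \<in> pverts T. int (graph_dist T y x) < \<bar>n\<bar> \<and> odd (\<bar>n\<bar> - int (graph_dist T y x))} =
      parity_ball x (\<bar>n\<bar> - 1)"
    unfolding parity_ball_def less_le ..
  then show ?thesis
    by (simp add: wave_S_def wave_M_eq)
qed

end

theorem theorem4p4:
  fixes T :: "'a pair_pre_digraph" and q :: nat
    and f g :: "'a \<Rightarrow> complex" and u :: "'a \<Rightarrow> int \<Rightarrow> complex"
  assumes "homogeneous_tree T q"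
    and wave_eq: "\<And>x n. x \<in> pverts T \<Longrightarrow>
      of_real (tree_gamma q) * laplacian_Z (\<lambda>m. u x m) n =
      laplacian_T T q (\<lambda>y. u y n) x - u x n + of_real (tree_gamma q) * u x n"
    and init_f: "\<And>x. x \<in> pverts T \<Longrightarrow> u x 0 = f x"
    and init_g: "\<And>x. x \<in> pverts T \<Longrightarrow> (u x 1 - u x (- 1)) / 2 = g x"
  shows "\<forall>x\<in>pverts T. \<forall>n::int. n \<noteq> 0 \<longrightarrow>
    u x n =
      1 / 2 * of_real (real q powr (- real_of_int \<bar>n\<bar> / 2)) *
        (\<Sum>y\<in>{y \<in> pverts T. int (graph_dist T y x) = \<bar>n\<bar>}. f y)
      - (of_nat q - 1) / 2 * of_real (real q powr (- real_of_int \<bar>n\<bar> / 2)) *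
        (\<Sum>y\<in>{y \<in> pverts T. int (graph_dist T y x) < \<bar>n\<bar> \<and> even (\<bar>n\<bar> - int (graph_dist T y x))}. f y)
      + of_int (sgn n) * of_real (real q powr (- (real_of_int \<bar>n\<bar> - 1) / 2)) *
        (\<Sum>y\<in>{y \<in> pverts T. int (graph_dist T y x) < \<bar>n\<bar> \<and> odd (\<bar>n\<bar> - int (graph_dist T y x))}. g y)
    \<and> u x n = wave_C T q n f x + wave_S T q n g x"
proof -
  interpret homogeneous_tree T q by fact
  let ?c = "complex_of_real (real q powr (- 1 / 2))"
  note step = wave_step[OF _ wave_eq]
  have sum1: "u x 1 + u x (- 1) = ?c * (\<Sum>z\<in>nbrs x. f z)" if "x \<in> pverts T" for x
  proof -
    have "(\<Sum>z\<in>nbrs x. u z 0) = (\<Sum>z\<in>nbrs x. f z)"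
      using init_f in_arcsD2 by (intro sum.cong) auto
    then show ?thesis
      using step[OF that that, of 0] by simp
  qed
  have plus1: "u x 1 = ?c * (\<Sum>z\<in>nbrs x. f z) / 2 + g x"
    and minus1: "u x (- 1) = ?c * (\<Sum>z\<in>nbrs x. f z) / 2 + (- g x)" if "x \<in> pverts T" for x
    using sum1[OF that, symmetric] init_g[OF that, symmetric] by (simp_all add: field_simps)
  have M_uminus: "wave_M T q n (\<lambda>y. - g y) x = - wave_M T q n g x" for n x
    by (simp add: wave_M_def sum_negf)
  have main: "u x n = wave_C T q n f x + wave_S T q n g x" if x: "x \<in> pverts T" and n: "n \<noteq> 0" for x n
  proof (cases "n > 0")
    case True
    define m where "m = nat (n - 1)"
    have m: "n = int m + 1"
      using True by (simp add: m_def)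
    have "u x (int (m + 1)) =
        (wave_M T q (int m + 1) f x - wave_M T q (int m - 1) f x) / 2 + wave_M T q (int m) g x"
    proof (rule wave_solution[of "\<lambda>x k. u x (int k)"])
      fix x k assume "x \<in> pverts T"
      from step[OF this this, of "int k + 1"]
      show "u x (int (k + 2)) + u x (int k) = ?c * (\<Sum>z\<in>nbrs x. u z (int (k + 1)))"
        by (simp add: add.commute)
    qed (use init_f plus1 x in auto)
    then show ?thesis
      using m by (simp add: wave_C_def wave_S_def add.commute)
  next
    case False
    define m where "m = nat (- n - 1)"
    have m: "n = - int (m + 1)"
      using False n by (simp add: m_def)
    have "u x (- int (m + 1)) =
        (wave_M T q (int m + 1) f x - wave_M T q (int m - 1) f x) / 2 +
        wave_M T q (int m) (\<lambda>y. - g y) x"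
    proof (rule wave_solution[of "\<lambda>x k. u x (- int k)"])
      fix x k assume "x \<in> pverts T"
      note step = step[OF this this, of "- int k - 1"]
      have shift: "- int (k + 1) = - int k - 1" "- int (k + 2) = - int k - 1 - 1"
        by simp_all
      show "u x (- int (k + 2)) + u x (- int k) = ?c * (\<Sum>z\<in>nbrs x. u z (- int (k + 1)))"
        unfolding shift using step by (simp add: add.commute)
    qed (use init_f minus1 x in auto)
    then show ?thesis
      using m by (simp add: wave_C_def wave_S_def M_uminus)
  qed
  show ?thesis
    using main wave_C_explicit wave_S_explicit by simp
qed

end
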